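(* Let $\mathbb{T}$ be a time scale, let $a,b\in\mathbb{T}$ with $a<b$, let $f:[a,b]\to\mathbb{R}$ be differentiable, and put $M=\sup_{a<x<b}|f^\Delta(x)|$. Suppose that $\alpha\in[a,b]\cap\mathbb{T}$. Then we have the sharp rectangle inequality on time scales $$\left|\int_a^b f^\sigma(t)\,\Delta t-\Big((\alpha-a)f(a)+(b-\alpha)f(b)\Big)\right|\le M\Big(h_2(a,\alpha)+h_2(b,\alpha)\Big).$$
   Context: A time scale $\mathbb{T}$ is an arbitrary nonempty closed subset of $\mathbb{R}$. An interval means the intersection of the real interval with $\mathbb{T}$. The forward jump operator is $\sigma(t)=\inf\{s\in\mathbb{T}:s>t\}$ (with $\sigma(t)=t$ if $t=\max\mathbb{T}$), and $f^\sigma(t)=f(\sigma(t))$. If $\mathbb{T}$ has a left-scattered maximum $m$ (i.e. $\sup\{s\in\mathbb{T}:s<m\}<m$), then $\mathbb{T}^\kappa=\mathbb{T}\setminus\{m\}$; otherwise $\mathbb{T}^\kappa=\mathbb{T}$. For $t\in\mathbb{T}^\kappa$, $f^\Delta(t)$ is the number, if it exists, such that for every $\varepsilon>0$ there is a neighborhood $U$ of $t$ in $\mathbb{T}$ with $|f(\sigma(t))-f(s)-f^\Delta(t)(\sigma(t)-s)|\le\varepsilon|\sigma(t)-s|$ for all $s\in U$. Differentiable means $\Delta$-differentiable, i.e. $f^\Delta(t)$ exists for all $t\in\mathbb{T}^\kappa$; for a function on $[a,b]$ this is read with the time scale $[a,b]\cap\mathbb{T}$ in place of $\mathbb{T}$.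 $F$ is a $\Delta$-antiderivative of $g$ if $F^\Delta=g$ on $\mathbb{T}^\kappa$ (with the same reading for functions on $[a,b]$), and then $\int_c^d g(t)\,\Delta t=F(d)-F(c)$. Define $h_0(t,s)=1$ and $h_{k+1}(t,s)=\int_s^t h_k(\tau,s)\,\Delta\tau$ for $s,t\in\mathbb{T}$; thus $h_2(t,s)=\int_s^t(\tau-s)\,\Delta\tau$. "Sharp" is used in the sense that the right-hand side of the inequality cannot be replaced by a smaller one.
   Formalization: When a is right-scattered and α > a, M is the supremum over a ≤ x < b instead of a < x < b, since the inequality is false otherwise (𝕋={0,1,2}, a=0, b=α=2, f(0)=0, f(1)=f(2)=1 gives left side 2, M=0). *)

theory Defs
  imports "HOL-Analysis.Analysis"
begin

definition time_scale :: "real set \<Rightarrow> bool" where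
  "time_scale T \<longleftrightarrow> closed T \<and> T \<noteq> {}"

definition fwd_jump :: "real set \<Rightarrow> real \<Rightarrow> real" where
  "fwd_jump T t = (if {s \<in> T. t < s} = {} then t else Inf {s \<in> T. t < s})"

text \<open>The supremum of the empty set of predecessors is not meaningful, so the only point of a
  one-point time scale does not count as left-scattered.\<close>

definition left_scattered_max :: "real set \<Rightarrow> real \<Rightarrow> bool" where
  "left_scattered_max T m \<longleftrightarrow>
     m \<in> T \<and> (\<forall>s\<in>T. s \<le> m) \<and> {s \<in> T. s < m} \<noteq> {} \<and> Sup {s \<in> T. s < m} < m"

definition kappa :: "real set \<Rightarrow> real set" where
  "kappa T = T - {m. left_scattered_max T m}"

text \<open>The neighbourhood includes the point \<open>t\<close> itself, which matters when \<open>t\<close> is right-scattered;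
  hence no filter of the form \<open>at t within T\<close>.\<close>

definition has_delta_deriv :: "real set \<Rightarrow> (real \<Rightarrow> real) \<Rightarrow> real \<Rightarrow> real \<Rightarrow> bool" where
  "has_delta_deriv T f D t \<longleftrightarrow>
     (\<forall>\<epsilon>>0. \<exists>U. open U \<and> t \<in> U \<and>
        (\<forall>s \<in> U \<inter> T. \<bar>f (fwd_jump T t) - f s - D * (fwd_jump T t - s)\<bar>
                      \<le> \<epsilon> * \<bar>fwd_jump T t - s\<bar>))"

definition delta_deriv :: "real set \<Rightarrow> (real \<Rightarrow> real) \<Rightarrow> real \<Rightarrow> real" where
  "delta_deriv T f t = (THE D. has_delta_deriv T f D t)"

definition delta_differentiable :: "real set \<Rightarrow> (real \<Rightarrow> real) \<Rightarrow> bool" where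
  "delta_differentiable T f \<longleftrightarrow> (\<forall>t \<in> kappa T. \<exists>D. has_delta_deriv T f D t)"

definition delta_antiderivative :: "real set \<Rightarrow> (real \<Rightarrow> real) \<Rightarrow> (real \<Rightarrow> real) \<Rightarrow> bool" where
  "delta_antiderivative T F g \<longleftrightarrow> (\<forall>t \<in> kappa T. has_delta_deriv T F (g t) t)"

definition delta_integral :: "real set \<Rightarrow> real \<Rightarrow> real \<Rightarrow> (real \<Rightarrow> real) \<Rightarrow> real" where
  "delta_integral T c d g = (THE I. \<exists>F. delta_antiderivative T F g \<and> I = F d - F c)"

primrec h_poly :: "real set \<Rightarrow> nat \<Rightarrow> real \<Rightarrow> real \<Rightarrow> real" where
  "h_poly T 0 t s = 1"
| "h_poly T (Suc k) t s = delta_integral T s t (\<lambda>\<tau>. h_poly T k \<tau> s)"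

text \<open>A function on \<open>[a,b]\<close> is a function on the time scale \<open>T \<inter> {a..b}\<close>. The supremum is taken in
  the extended reals, since the derivative need not be bounded. It ranges over the points of the
  time scale in \<open>(a,b)\<close>, and additionally over \<open>a\<close> when \<open>a\<close> is right-scattered and
  \<open>a < \<alpha>\<close>: there the value \<open>f a\<close> enters the error below with weight \<open>\<alpha> - a\<close> but does not
  influence the derivative on \<open>(a,b)\<close>, so no bound in terms of the latter alone can hold.\<close>

definition deriv_bound :: "real set \<Rightarrow> real \<Rightarrow> real \<Rightarrow> real \<Rightarrow> (real \<Rightarrow> real) \<Rightarrow> ereal" where
  "deriv_bound T a b \<alpha> f =
     (SUP x \<in> (if a < fwd_jump T a \<and> a < \<alpha> then T \<inter> {a..<b} else T \<inter> {a<..<b}).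
        ereal \<bar>delta_deriv (T \<inter> {a..b}) f x\<bar>)"

definition rectangle_error :: "real set \<Rightarrow> real \<Rightarrow> real \<Rightarrow> real \<Rightarrow> (real \<Rightarrow> real) \<Rightarrow> real" where
  "rectangle_error T a b \<alpha> f =
     \<bar>delta_integral (T \<inter> {a..b}) a b (\<lambda>t. f (fwd_jump (T \<inter> {a..b}) t))
        - ((\<alpha> - a) * f a + (b - \<alpha>) * f b)\<bar>"

end

theory Submission
  imports Defs
begin

text \<open>Let \<open>F\<close> be an antiderivative of \<open>f \<circ> \<sigma>\<close>. By the product rule \<open>G t = (t - \<alpha>) f t - F t\<close> has the
  \<open>\<Delta>\<close>-derivative \<open>(t - \<alpha>) f\<^sup>\<Delta> t\<close>, and the error to be estimated is \<open>\<bar>G b - G a\<bar>\<close>.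
  The mean value inequality, applied separately on both sides of \<open>\<alpha>\<close>, compares \<open>G\<close> with an
  antiderivative of \<open>t - \<alpha>\<close>, whose increments are the values of \<open>h\<^sub>2\<close>. For sharpness,
  \<open>f\<^sup>\<Delta> t\<close> should be \<open>K sgn (t - \<alpha>)\<close>. If \<open>\<alpha>\<close> is not left-dense, \<open>f t = K \<bar>t - \<alpha>\<bar>\<close> is
  differentiable and does this exactly; otherwise \<open>f\<close> is an antiderivative of \<open>q \<circ> \<sigma>\<close> with a
  continuous approximation \<open>q\<close> of the sign function.\<close>

section \<open>The forward jump operator\<close>

lemma fwd_jump_ge: "t \<le> fwd_jump T t"
  unfolding fwd_jump_def by (auto intro!: cInf_greatest)

lemma fwd_jump_le:
  assumes "s \<in> T" "t < s"
  shows "fwd_jump T t \<le> s"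
  using assms unfolding fwd_jump_def by (auto intro!: cInf_lower bdd_belowI[of _ t])

lemma fwd_jump_in:
  assumes "closed T" "t \<in> T"
  shows "fwd_jump T t \<in> T"
proof (cases "{s \<in> T. t < s} = {}")
  case False
  have "Inf {s \<in> T. t < s} \<in> closure {s \<in> T. t < s}"
    using False by (intro closure_contains_Inf) (auto intro!: bdd_belowI[of _ t])
  also have "\<dots> \<subseteq> T"
    using assms(1) by (intro closure_minimal) auto
  finally show ?thesis
    using False by (subst fwd_jump_def) (simp only: if_False)
qed (use assms in \<open>simp add: fwd_jump_def\<close>)

text \<open>The point \<open>d\<close> excludes the default value of the jump at a maximum. Hence
  \<open>t\<close> is the infimum of the points after it, and some of them lie below
  \<open>u\<close>.\<close>

lemma fwd_jump_dense:
  assumes "fwd_jump T t = t" "d \<in> T" "t < d" "t < u"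
  obtains s where "s \<in> T" "t < s" "s < u"
proof -
  have "Inf {s \<in> T. t < s} < u" and ne: "{s \<in> T. t < s} \<noteq> {}"
    using assms by (auto simp: fwd_jump_def split: if_splits)
  from cInf_lessD[OF ne this(1)] show ?thesis
    using that by auto
qed

text \<open>The infimum is decided by the points up to \<open>b\<close>, since \<open>b\<close>
  itself is a candidate when \<open>t < b\<close>. At \<open>b\<close> the two jumps can
  differ.\<close>

lemma fwd_jump_Int_atLeastAtMost:
  assumes "closed T" "a \<le> t" "t < b" "b \<in> T"
  shows "fwd_jump (T \<inter> {a..b}) t = fwd_jump T t"
proof (rule antisym)
  have ne: "{s \<in> T \<inter> {a..b}. t < s} \<noteq> {}"
    using assms by auto
  show "fwd_jump T t \<le> fwd_jump (T \<inter> {a..b}) t"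
    using ne assms by (auto simp: fwd_jump_def intro!: cInf_superset_mono bdd_belowI[of _ t])
  have "fwd_jump (T \<inter> {a..b}) t \<le> s" if "s \<in> T" "t < s" for s
    using fwd_jump_le[of s "T \<inter> {a..b}" t] fwd_jump_le[of b "T \<inter> {a..b}" t] that assms
    by (cases "s \<le> b") auto
  then show "fwd_jump (T \<inter> {a..b}) t \<le> fwd_jump T t"
    using ne by (auto simp: fwd_jump_def[of T] intro!: cInf_greatest)
qed

section \<open>The delta derivative and its rules\<close>

lemma less_imp_kappa: "t \<in> T \<Longrightarrow> u \<in> T \<Longrightarrow> t < u \<Longrightarrow> t \<in> kappa T"
  by (force simp: kappa_def left_scattered_max_def)

text \<open>This separates two kinds of points. At a right-scattered \<open>t\<close> the derivative
  is the difference quotient across the gap, together with continuity. Where the jump fixes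
  \<open>t\<close>, it is the ordinary derivative within \<open>T\<close>, and the first two
  conjuncts follow. Later rules thus reduce to ordinary calculus.\<close>

lemma has_delta_deriv_iff:
  assumes "t \<in> T"
  shows "has_delta_deriv T f D t \<longleftrightarrow>
    continuous (at t within T) f \<and> f (fwd_jump T t) - f t = D * (fwd_jump T t - t) \<and>
    (fwd_jump T t = t \<longrightarrow> (f has_real_derivative D) (at t within T))"
proof (cases "fwd_jump T t = t")
  case True
  have "has_delta_deriv T f D t \<longleftrightarrow> (f has_real_derivative D) (at t within T)" (is "?L \<longleftrightarrow> ?R")
  proof
    assume ?L
    show ?R
      unfolding has_field_derivative_def has_derivative_within_alt
    proof (intro conjI allI impI)
      fix e :: real assume "e > 0"
      then obtain U where "open U" "t \<in> U"
        and U: "\<forall>s\<in>U \<inter> T. \<bar>f t - f s - D * (t - s)\<bar> \<le> e * \<bar>t - s\<bar>"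
        using \<open>?L\<close> True unfolding has_delta_deriv_def by metis
      then obtain d where "d > 0" "ball t d \<subseteq> U"
        using open_contains_ball by blast
      have "norm (f y - f t - D * (y - t)) \<le> e * norm (y - t)"
        if "y \<in> T" "norm (y - t) < d" for y
      proof -
        have "y \<in> U"
          using that \<open>ball t d \<subseteq> U\<close> by (auto simp: dist_norm norm_minus_commute subset_iff)
        moreover have "f y - f t - D * (y - t) = - (f t - f y - D * (t - y))"
          by (simp add: algebra_simps)
        ultimately show ?thesis
          using U that by (metis IntI abs_minus_cancel abs_minus_commute real_norm_def)
      qed
      then show "\<exists>d>0. \<forall>y\<in>T. norm (y - t) < d \<longrightarrow> norm (f y - f t - D * (y - t)) \<le> e * norm (y - t)"
        using \<open>d > 0\<close> by blast
    qed (rule bounded_linear_mult_right)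
  next
    assume ?R
    show ?L
      unfolding has_delta_deriv_def True
    proof (intro allI impI)
      fix e :: real assume "e > 0"
      then obtain d where "d > 0" and d: "\<And>y. y \<in> T \<Longrightarrow> norm (y - t) < d \<Longrightarrow>
          norm (f y - f t - D * (y - t)) \<le> e * norm (y - t)"
        using \<open>?R\<close> unfolding has_field_derivative_def has_derivative_within_alt by blast
      have "\<bar>f t - f s - D * (t - s)\<bar> \<le> e * \<bar>t - s\<bar>" if "s \<in> ball t d \<inter> T" for s
      proof -
        have "f t - f s - D * (t - s) = - (f s - f t - D * (s - t))"
          by (simp add: algebra_simps)
        then show ?thesis
          using d[of s] that
          by (simp only: abs_minus_cancel) (simp add: dist_norm abs_minus_commute)
      qed
      then show "\<exists>U. open U \<and> t \<in> U \<and> (\<forall>s\<in>U \<inter> T. \<bar>f t - f s - D * (t - s)\<bar> \<le> e * \<bar>t - s\<bar>)"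
        using \<open>d > 0\<close> by (intro exI[of _ "ball t d"]) auto
    qed
  qed
  then show ?thesis
    using True DERIV_continuous by auto
next
  case False
  define m where "m = fwd_jump T t - t"
  have m: "m > 0" "fwd_jump T t = t + m"
    using False fwd_jump_ge[of t T] by (auto simp: m_def)
  have "has_delta_deriv T f D t \<longleftrightarrow>
    continuous (at t within T) f \<and> f (t + m) - f t = D * m" (is "?L \<longleftrightarrow> ?R")
  proof
    assume ?L
    have jump: "f (t + m) - f t = D * m"
    proof -
      have "\<bar>f (t + m) - f t - D * m\<bar> \<le> 0 + e" if "e > 0" for e
      proof -
        \<comment> \<open>The tolerance is scaled so that the choice \<open>s = t\<close> leaves
          exactly the error \<open>e\<close>.\<close>
        have "e / m > 0"
          using that m by simp
        then obtain U where "open U" "t \<in> U"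
          "\<forall>s\<in>U \<inter> T. \<bar>f (t + m) - f s - D * (t + m - s)\<bar> \<le> e / m * \<bar>t + m - s\<bar>"
          using \<open>?L\<close> unfolding has_delta_deriv_def m by metis
        then show ?thesis
          using assms m by force
      qed
      then have "\<bar>f (t + m) - f t - D * m\<bar> \<le> 0"
        by (rule field_le_epsilon)
      then show ?thesis
        by simp
    qed
    moreover have "continuous (at t within T) f"
      unfolding continuous_within_eps_delta
    proof (intro allI impI)
      fix e :: real assume "e > 0"
      \<comment> \<open>Within distance 1 of \<open>t\<close> the point \<open>s\<close> is at most
        \<open>m + 1\<close> away from the jump, so this error is at most \<open>e / 2\<close>; the
        other half is for \<open>D * (t - s)\<close>.\<close>
      define e' where "e' = e / (2 * (m + 1))"
      have e': "e' > 0" "e' * (m + 1) = e / 2"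
        using \<open>e > 0\<close> m by (auto simp: e'_def field_simps)
      obtain U where "open U" "t \<in> U" and
        U: "\<forall>s\<in>U \<inter> T. \<bar>f (t + m) - f s - D * (t + m - s)\<bar> \<le> e' * \<bar>t + m - s\<bar>"
        using \<open>?L\<close> e'(1) unfolding has_delta_deriv_def m by metis
      then obtain r where r: "r > 0" "ball t r \<subseteq> U"
        using open_contains_ball by blast
      define d where "d = min (min r 1) (e / (2 * (\<bar>D\<bar> + 1)))"
      have "d > 0"
        using r \<open>e > 0\<close> by (auto simp: d_def)
      moreover have "dist (f s) (f t) < e" if "s \<in> T" "dist s t < d" for s
      proof -
        have "s \<in> U"
          using that r by (auto simp: d_def dist_commute subset_iff)
        then have "\<bar>f (t + m) - f s - D * (t + m - s)\<bar> \<le> e' * \<bar>t + m - s\<bar>"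
          using U that by blast
        also have "\<dots> \<le> e' * (m + 1)"
          using that e'(1) m by (intro mult_left_mono) (auto simp: d_def dist_real_def)
        finally have 1: "\<bar>f t - f s - D * (t - s)\<bar> \<le> e / 2"
          using jump e'(2) by (simp add: algebra_simps)
        have "\<bar>D * (t - s)\<bar> \<le> (\<bar>D\<bar> + 1) * \<bar>t - s\<bar>"
          by (simp add: abs_mult mult_right_mono)
        also have "\<dots> < (\<bar>D\<bar> + 1) * (e / (2 * (\<bar>D\<bar> + 1)))"
          using that by (intro mult_strict_left_mono) (auto simp: d_def dist_real_def)
        also have "\<dots> = e / 2"
          by (simp add: field_simps)
        finally show ?thesis
          using 1 unfolding dist_real_def by linarith
      qed
      ultimately show "\<exists>d>0. \<forall>x'\<in>T. dist x' t < d \<longrightarrow> dist (f x') (f t) < e"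
        by blast
    qed
    ultimately show ?R
      by blast
  next
    assume ?R
    show ?L
      unfolding has_delta_deriv_def m
    proof (intro allI impI)
      fix e :: real assume "e > 0"
      have "continuous (at t within T) (\<lambda>s. f t - f s - D * (t - s))"
        using \<open>?R\<close> by (intro continuous_intros) auto
      then obtain d where "d > 0" and
        d: "\<forall>s\<in>T. dist s t < d \<longrightarrow> \<bar>f t - f s - D * (t - s)\<bar> < e * (m / 2)"
        unfolding continuous_within_eps_delta dist_real_def
        using \<open>e > 0\<close> m(1) by (elim allE[of _ "e * (m / 2)"]) auto
      \<comment> \<open>Within \<open>m / 2\<close> of \<open>t\<close>, the point \<open>s\<close>
        stays at least \<open>m / 2\<close> away from the jump, so the error
        \<open>e * (m / 2)\<close> is affordable.\<close>
      define r where "r = min d (m / 2)"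
      have "\<bar>f (t + m) - f s - D * (t + m - s)\<bar> \<le> e * \<bar>t + m - s\<bar>" if "s \<in> ball t r \<inter> T" for s
      proof -
        have "\<bar>f (t + m) - f s - D * (t + m - s)\<bar> = \<bar>f t - f s - D * (t - s)\<bar>"
          using \<open>?R\<close> by (simp add: algebra_simps)
        also have "\<dots> \<le> e * (m / 2)"
          using d that by (auto simp: r_def dist_commute intro: less_imp_le)
        also have "\<dots> \<le> e * \<bar>t + m - s\<bar>"
          using that \<open>e > 0\<close> m(1) unfolding r_def
          by (intro mult_left_mono) (simp_all add: dist_real_def abs_if split: if_splits)
        finally show ?thesis .
      qed
      then show "\<exists>U. open U \<and> t \<in> U \<and>
          (\<forall>s\<in>U \<inter> T. \<bar>f (t + m) - f s - D * (t + m - s)\<bar> \<le> e * \<bar>t + m - s\<bar>)"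
        using \<open>d > 0\<close> m by (intro exI[of _ "ball t r"]) (auto simp: r_def)
    qed
  qed
  then show ?thesis
    using m by simp
qed

lemma has_delta_deriv_subset:
  assumes "has_delta_deriv T f D t" "S \<subseteq> T" "fwd_jump S t = fwd_jump T t"
  shows "has_delta_deriv S f D t"
  unfolding has_delta_deriv_def assms(3)
proof (intro allI impI)
  fix e :: real assume "e > 0"
  with assms(1) obtain U where "open U" "t \<in> U" "\<forall>s\<in>U \<inter> T.
      \<bar>f (fwd_jump T t) - f s - D * (fwd_jump T t - s)\<bar> \<le> e * \<bar>fwd_jump T t - s\<bar>"
    unfolding has_delta_deriv_def by blast
  then show "\<exists>U. open U \<and> t \<in> U \<and> (\<forall>s\<in>U \<inter> S.
      \<bar>f (fwd_jump T t) - f s - D * (fwd_jump T t - s)\<bar> \<le> e * \<bar>fwd_jump T t - s\<bar>)"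
    using assms(2) by (intro exI[of _ U]) auto
qed

lemma has_delta_deriv_id: "has_delta_deriv T (\<lambda>x. x) 1 t"
  unfolding has_delta_deriv_def by (auto intro!: exI[of _ UNIV])

lemma has_delta_deriv_linear_comb:
  assumes "t \<in> T" "has_delta_deriv T f D t" "has_delta_deriv T g E t"
  shows "has_delta_deriv T (\<lambda>x. p * f x + q * g x) (p * D + q * E) t"
proof -
  have "p * f (fwd_jump T t) + q * g (fwd_jump T t) - (p * f t + q * g t)
      = p * (f (fwd_jump T t) - f t) + q * (g (fwd_jump T t) - g t)"
    by (simp add: algebra_simps)
  also have "\<dots> = (p * D + q * E) * (fwd_jump T t - t)"
    using assms by (simp add: has_delta_deriv_iff) (simp add: algebra_simps)
  finally show ?thesis
    using assms by (auto simp: has_delta_deriv_iff intro!: continuous_intros derivative_eq_intros)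
qed

lemma has_delta_deriv_diff:
  assumes "t \<in> T" "has_delta_deriv T f D t" "has_delta_deriv T g E t"
  shows "has_delta_deriv T (\<lambda>x. f x - g x) (D - E) t"
  using has_delta_deriv_linear_comb[OF assms, of 1 "-1"] by simp

text \<open>Product rule in the form that evaluates \<open>f\<close> at the forward jump; this is
  how the integrand \<open>f \<circ> \<sigma>\<close> arises.\<close>

lemma has_delta_deriv_times_shift:
  assumes "t \<in> T" "has_delta_deriv T f D t"
  shows "has_delta_deriv T (\<lambda>x. (x - c) * f x) (f (fwd_jump T t) + (t - c) * D) t"
proof -
  have "(fwd_jump T t - c) * f (fwd_jump T t) - (t - c) * f t
      = (fwd_jump T t - t) * f (fwd_jump T t) + (t - c) * (f (fwd_jump T t) - f t)"
    by (simp add: algebra_simps)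
  also have "f (fwd_jump T t) - f t = D * (fwd_jump T t - t)"
    using assms by (simp add: has_delta_deriv_iff)
  finally have "(fwd_jump T t - c) * f (fwd_jump T t) - (t - c) * f t
      = (f (fwd_jump T t) + (t - c) * D) * (fwd_jump T t - t)"
    by (simp add: algebra_simps)
  then show ?thesis
    using assms by (auto simp: has_delta_deriv_iff intro!: continuous_intros derivative_eq_intros)
qed

text \<open>The later point \<open>u\<close> makes \<open>t\<close> either right-scattered, where
  the increment across the gap determines the value, or a limit point of \<open>T\<close>. At an
  isolated maximum every number would be a derivative.\<close>

lemma has_delta_deriv_unique:
  assumes "t \<in> T" "u \<in> T" "t < u" "has_delta_deriv T f D t" "has_delta_deriv T f E t"
  shows "D = E"
proof (cases "fwd_jump T t = t")
  case True
  have "t islimpt T"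
    unfolding islimpt_approachable_real
  proof (intro allI impI)
    fix e :: real assume "e > 0"
    then obtain s where "s \<in> T" "t < s" "s < t + e"
      using fwd_jump_dense[OF True assms(2,3), of "t + e"] by auto
    then show "\<exists>x'\<in>T. x' \<noteq> t \<and> \<bar>x' - t\<bar> < e"
      by (intro bexI[of _ s]) auto
  qed
  then have "at t within T \<noteq> bot"
    by (simp add: trivial_limit_within)
  then show ?thesis
    using assms True by (auto simp: has_delta_deriv_iff has_field_derivative_iff intro: tendsto_unique)
next
  case False
  then show ?thesis
    using assms by (auto simp: has_delta_deriv_iff)
qed

lemma delta_deriv_eq:
  assumes "t \<in> T" "u \<in> T" "t < u" "has_delta_deriv T f D t"
  shows "delta_deriv T f t = D"
  unfolding delta_deriv_def using has_delta_deriv_unique[OF assms(1-3)] assms(4) by blast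

text \<open>The only point of \<open>T\<close> that can lie outside \<open>kappa T\<close> is a
  left-scattered maximum, and this is isolated in \<open>T\<close>.\<close>

lemma continuous_on_delta_antiderivative:
  assumes "delta_antiderivative T F g"
  shows "continuous_on T F"
  unfolding continuous_on_eq_continuous_within
proof
  fix t assume "t \<in> T"
  show "continuous (at t within T) F"
  proof (cases "t \<in> kappa T")
    case True
    then show ?thesis
      using assms \<open>t \<in> T\<close> by (auto simp: delta_antiderivative_def has_delta_deriv_iff)
  next
    case False
    then have t: "\<forall>s\<in>T. s \<le> t" "{s \<in> T. s < t} \<noteq> {}" "Sup {s \<in> T. s < t} < t"
      using \<open>t \<in> T\<close> by (auto simp: kappa_def left_scattered_max_def)
    have "s = t" if "s \<in> T" "dist s t < t - Sup {s \<in> T. s < t}" for s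
    proof (rule ccontr)
      assume "s \<noteq> t"
      then have "s < t"
        using t that by force
      then have "s \<le> Sup {s \<in> T. s < t}"
        using that by (intro cSup_upper) (auto intro!: bdd_aboveI[of _ t])
      then show False
        using that \<open>s < t\<close> by (simp add: dist_real_def)
    qed
    then show ?thesis
      unfolding continuous_within_eps_delta using t(3)
      by (intro allI impI exI[of _ "t - Sup {s \<in> T. s < t}"])
         (metis diff_gt_0_iff_gt dist_self)
  qed
qed

section \<open>Monotonicity from a nonnegative delta derivative\<close>

text \<open>Continuous induction along \<open>T\<close>. The slack \<open>e * (t - c)\<close>
  absorbs the error in the definition of the derivative. The supremum \<open>m\<close> of the points
  up to which the slackened inequality holds inherits it by continuity and can be passed unless
  \<open>m = d\<close>. Finally \<open>e\<close> tends to 0.\<close>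

lemma delta_mono_left_closed:
  assumes T: "closed T" and cd: "c \<in> T" "d \<in> T" "c \<le> d"
    and cont: "continuous_on (T \<inter> {c..d}) Q"
    and der: "\<And>t. t \<in> T \<Longrightarrow> c \<le> t \<Longrightarrow> t < d \<Longrightarrow> \<exists>D\<ge>0. has_delta_deriv T Q D t"
  shows "Q c \<le> Q d"
proof -
  have bound: "Q c \<le> Q d + e * (d - c)" if "e > 0" for e
  proof -
    define h where "h t = Q t + e * (t - c)" for t
    define S where "S = {t \<in> T \<inter> {c..d}. \<forall>s\<in>T \<inter> {c..t}. Q c \<le> h s}"
    define m where "m = Sup S"
    have cS: "c \<in> S"
      using cd by (auto simp: S_def h_def)
    have bdd: "bdd_above S"
      by (auto simp: S_def intro!: bdd_aboveI[of _ d])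
    have upper: "t \<le> m" if "t \<in> S" for t
      unfolding m_def using bdd that by (intro cSup_upper)
    have near: "\<exists>t\<in>S. u < t" if "u < m" for u
      using less_cSup_iff[of S u] cS bdd that unfolding m_def by blast
    have "m \<in> closure S"
      unfolding m_def using cS bdd by (intro closure_contains_Sup) auto
    also have "closure S \<subseteq> T \<inter> {c..d}"
      using T by (intro closure_minimal) (auto simp: S_def)
    finally have mT: "m \<in> T" "c \<le> m" "m \<le> d"
      by auto
    have "continuous_on (T \<inter> {c..d}) h"
      unfolding h_def by (intro continuous_intros cont)
    then have conth: "continuous (at m within T \<inter> {c..d}) h"
      using mT by (auto simp: continuous_on_eq_continuous_within)
    \<comment> \<open>A failure at the supremum would persist, by continuity, at members of
      \<open>S\<close> close to \<open>m\<close>.\<close>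
    have hm: "Q c \<le> h m"
    proof (rule ccontr)
      assume "\<not> ?thesis"
      then have "Q c - h m > 0"
        by simp
      then obtain r where "r > 0"
        and r: "\<And>t. t \<in> T \<inter> {c..d} \<Longrightarrow> dist t m < r \<Longrightarrow> dist (h t) (h m) < Q c - h m"
        using conth unfolding continuous_within_eps_delta by meson
      obtain t where t: "t \<in> S" "m - r < t"
        using near[of "m - r"] \<open>r > 0\<close> by auto
      then have "t \<in> T \<inter> {c..d}" "dist t m < r" "Q c \<le> h t"
        using upper[of t] by (auto simp: S_def dist_real_def)
      then show False
        using r[of t] by (simp add: dist_real_def)
    qed
    have low: "Q c \<le> h s" if s: "s \<in> T" "c \<le> s" "s \<le> m" for s
    proof (cases "s = m")
      case False
      then obtain t where "t \<in> S" "s < t"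
        using near[of s] s by force
      then show ?thesis
        using that by (auto simp: S_def)
    qed (use hm in simp)
    have "m = d"
    proof (rule ccontr)
      assume "m \<noteq> d"
      then have md: "m < d"
        using mT by simp
      obtain D where "D \<ge> 0" and D: "has_delta_deriv T Q D m"
        using der[OF mT(1,2) md] by blast
      \<comment> \<open>Passing \<open>m\<close>: if it is right-dense, the derivative with
        tolerance \<open>e\<close> controls a short stretch; if it is right-scattered, its jump is
        the only new point.\<close>
      have "\<exists>u\<in>T \<inter> {m<..d}. \<forall>s\<in>T \<inter> {m<..u}. Q m - e * (s - m) \<le> Q s"
      proof (cases "fwd_jump T m = m")
        case True
        obtain U where "open U" "m \<in> U"
          and U: "\<forall>s\<in>U \<inter> T. \<bar>Q m - Q s - D * (m - s)\<bar> \<le> e * \<bar>m - s\<bar>"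
          using D \<open>e > 0\<close> True unfolding has_delta_deriv_def by metis
        then obtain r where r: "r > 0" "ball m r \<subseteq> U"
          using open_contains_ball by blast
        obtain u where u: "u \<in> T" "m < u" "u < min (m + r) d"
          using fwd_jump_dense[OF True \<open>d \<in> T\<close> md, of "min (m + r) d"] r md by auto
        have "Q m - e * (s - m) \<le> Q s" if "s \<in> T \<inter> {m<..u}" for s
        proof -
          have "s \<in> U"
            using r u that by (auto simp: dist_real_def subset_iff)
          then have "\<bar>Q m - Q s - D * (m - s)\<bar> \<le> e * (s - m)"
            using U[rule_format, of s] that by (simp add: abs_minus_commute[of m s])
          moreover have "D * (m - s) \<le> 0"
            using that \<open>D \<ge> 0\<close> by (intro mult_nonneg_nonpos) auto
          ultimately show ?thesis
            by linarith
        qed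
        then show ?thesis
          using u by (intro bexI[of _ u]) auto
      next
        case False
        define u where "u = fwd_jump T m"
        have u: "m < u" "u \<in> T" "u \<le> d"
          using False fwd_jump_ge[of m T] fwd_jump_in[OF T mT(1)] fwd_jump_le[OF \<open>d \<in> T\<close> md]
          by (auto simp: u_def)
        have "Q u - Q m = D * (u - m)"
          using D mT by (simp add: has_delta_deriv_iff u_def)
        then have "Q m \<le> Q u"
          using \<open>D \<ge> 0\<close> u by (metis diff_ge_0_iff_ge less_imp_le mult_nonneg_nonneg)
        moreover have "s = u" if "s \<in> T \<inter> {m<..u}" for s
          using that fwd_jump_le[of s T m] by (auto simp: u_def)
        moreover have "0 \<le> e * (u - m)"
          using \<open>e > 0\<close> u by simp
        ultimately have "\<forall>s\<in>T \<inter> {m<..u}. Q m - e * (s - m) \<le> Q s"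
          by fastforce
        then show ?thesis
          using u by (intro bexI[of _ u]) auto
      qed
      then obtain u where u: "u \<in> T" "m < u" "u \<le> d"
        and Qu: "\<forall>s\<in>T \<inter> {m<..u}. Q m - e * (s - m) \<le> Q s"
        by auto
      have "Q c \<le> h s" if "s \<in> T" "c \<le> s" "s \<le> u" for s
      proof (cases "s \<le> m")
        case False
        then have "Q m - e * (s - m) \<le> Q s"
          using Qu that by auto
        then show ?thesis
          using hm by (simp add: h_def algebra_simps)
      qed (use low that in auto)
      then have "u \<in> S"
        using u mT by (auto simp: S_def)
      then show False
        using upper u by force
    qed
    then show ?thesis
      using hm by (simp add: h_def)
  qed
  show ?thesis
  proof (cases "c = d")
    case False
    have "Q c \<le> Q d + e" if "e > 0" for e
      using bound[of "e / (d - c)"] that False cd by simp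
    then show ?thesis
      by (rule field_le_epsilon)
  qed simp
qed

text \<open>A right-dense \<open>c\<close> is approached by points \<open>s > c\<close> with
  \<open>Q s \<le> Q d\<close>, and continuity carries this to \<open>c\<close>. So a derivative at
  \<open>c\<close> is demanded only across a gap, as in \<open>deriv_bound\<close>.\<close>

lemma delta_mono:
  assumes T: "closed T" and cd: "c \<in> T" "d \<in> T" "c \<le> d"
    and cont: "continuous_on (T \<inter> {c..d}) Q"
    and der: "\<And>t. t \<in> T \<Longrightarrow> c < t \<or> c = t \<and> c < fwd_jump T c \<Longrightarrow> t < d \<Longrightarrow>
      \<exists>D\<ge>0. has_delta_deriv T Q D t"
  shows "Q c \<le> Q d"
proof (cases "c < d \<and> fwd_jump T c = c")
  case False
  show ?thesis
  proof (cases "c = d")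
    case neq: False
    then have "c < fwd_jump T c"
      using False fwd_jump_ge[of c T] cd by auto
    then show ?thesis
      by (intro delta_mono_left_closed[OF T cd cont]) (auto intro!: der)
  qed simp
next
  case True
  have later: "Q s \<le> Q d" if "s \<in> T" "c < s" "s < d" for s
  proof (rule delta_mono_left_closed[OF T, where Q = Q])
    show "continuous_on (T \<inter> {s..d}) Q"
      using that by (intro continuous_on_subset[OF cont]) auto
  qed (use that cd der in auto)
  show ?thesis
  proof (rule ccontr)
    assume "\<not> ?thesis"
    then have "Q c - Q d > 0"
      by simp
    moreover have "continuous (at c within T \<inter> {c..d}) Q"
      using cont cd by (auto simp: continuous_on_eq_continuous_within)
    ultimately obtain r where "r > 0"
      and r: "\<And>t. t \<in> T \<inter> {c..d} \<Longrightarrow> dist t c < r \<Longrightarrow> dist (Q t) (Q c) < Q c - Q d"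
      unfolding continuous_within_eps_delta by meson
    obtain s where s: "s \<in> T" "c < s" "s < min (c + r) d"
      using fwd_jump_dense[of T c d "min (c + r) d"] True cd \<open>r > 0\<close> by auto
    then have "dist (Q s) (Q c) < Q c - Q d"
      by (intro r) (auto simp: dist_real_def)
    then show False
      using later[of s] s by (simp add: dist_real_def)
  qed
qed

section \<open>Antiderivatives and the delta integral\<close>

text \<open>The difference of two antiderivatives has derivative 0, so it and its negative are both
  monotone. This makes \<open>delta_integral\<close> well defined.\<close>

lemma delta_antiderivative_unique:
  assumes "closed T" "c \<in> T" "d \<in> T"
    and "delta_antiderivative T F g" "delta_antiderivative T G g"
  shows "F d - F c = G d - G c"
proof -
  have le: "F y - G y = F x - G x" if xy: "x \<in> T" "y \<in> T" "x \<le> y" for x y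
  proof -
    have der: "\<exists>D\<ge>0. has_delta_deriv T (\<lambda>s. P s - R s) D t"
      if "delta_antiderivative T P g" "delta_antiderivative T R g" "t \<in> T" "t < y" for P R t
      using has_delta_deriv_diff[of t T P "g t" R "g t"] that less_imp_kappa[of t T y] xy
      by (auto simp: delta_antiderivative_def)
    have mono: "P x - R x \<le> P y - R y"
      if "delta_antiderivative T P g" "delta_antiderivative T R g" for P R
    proof (rule delta_mono_left_closed[OF assms(1) xy])
      have "continuous_on T (\<lambda>s. P s - R s)"
        using that by (intro continuous_on_diff continuous_on_delta_antiderivative)
      then show "continuous_on (T \<inter> {x..y}) (\<lambda>s. P s - R s)"
        by (rule continuous_on_subset) simp
    qed (rule der[OF that])
    show ?thesis
      using mono[OF assms(4,5)] mono[OF assms(5,4)] by simp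
  qed
  show ?thesis
    using le[of c d] le[of d c] assms by (cases "c \<le> d") auto
qed

lemma delta_integral_eq:
  assumes "closed T" "c \<in> T" "d \<in> T" "delta_antiderivative T F g"
  shows "delta_integral T c d g = F d - F c"
  unfolding delta_integral_def
proof (rule the_equality)
  show "I = F d - F c" if "\<exists>G. delta_antiderivative T G g \<and> I = G d - G c" for I
  proof -
    from that obtain G where "delta_antiderivative T G g" "I = G d - G c"
      by blast
    then show ?thesis
      using delta_antiderivative_unique[OF assms(1-3) _ assms(4)] by simp
  qed
qed (use assms(4) in blast)

text \<open>The antiderivative is the integral of \<open>g \<circ> N\<close>, where \<open>g\<close> is a Tietze extension of \<open>f\<close> and \<open>N x\<close>
  is the first point of \<open>T\<close> at or after \<open>x\<close>; as \<open>N\<close> is monotone, \<open>g \<circ> N\<close> is measurable.\<close>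

lemma exists_delta_antiderivative_fwd_jump:
  assumes T: "closed T" and f: "continuous_on T f"
  shows "\<exists>F. delta_antiderivative T F (\<lambda>t. f (fwd_jump T t))"
proof (cases "T = {}")
  case True
  then show ?thesis
    by (simp add: delta_antiderivative_def kappa_def)
next
  case False
  then obtain c where c: "c \<in> T"
    by blast
  obtain g :: "real \<Rightarrow> real" where g: "continuous_on UNIV g" "\<And>x. x \<in> T \<Longrightarrow> g x = f x"
    using Tietze_unbounded[of T f UNIV] f T by (auto simp: subtopology_UNIV simp flip: closed_closedin)
  \<comment> \<open>Past the last point of \<open>T\<close> the default \<open>x\<close> preserves
    monotonicity and \<open>x \<le> N x\<close>.\<close>
  define N where "N x = (if \<exists>s\<in>T. x \<le> s then Inf {s \<in> T. x \<le> s} else x)" for x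
  have N_le: "N x \<le> s" if "s \<in> T" "x \<le> s" for x s
    using that by (auto simp: N_def intro!: cInf_lower bdd_belowI[of _ x])
  have N_ge: "x \<le> N x" for x
    by (auto simp: N_def intro!: cInf_greatest)
  have N_in: "N x \<in> T" if "s \<in> T" "x \<le> s" for x s
  proof -
    have "Inf {s \<in> T. x \<le> s} \<in> closure {s \<in> T. x \<le> s}"
      using that by (intro closure_contains_Inf) (auto intro!: bdd_belowI[of _ x])
    also have "\<dots> \<subseteq> T"
      using T by (intro closure_minimal) auto
    finally show ?thesis
      using that by (auto simp: N_def)
  qed
  have "mono N"
  proof (rule monoI)
    fix x y :: real assume "x \<le> y"
    show "N x \<le> N y"
    proof (cases "\<exists>s\<in>T. y \<le> s")
      case True
      then obtain s where "s \<in> T" "y \<le> s"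
        by blast
      then show ?thesis
        using N_in[of s y] N_ge[of y] \<open>x \<le> y\<close> by (intro N_le) auto
    next
      case no_y: False
      show ?thesis
      proof (cases "\<exists>s\<in>T. x \<le> s")
        case True
        then obtain s where "s \<in> T" "x \<le> s"
          by blast
        then show ?thesis
          using N_in[of s x] no_y by (force simp: N_def[of y])
      qed (use \<open>x \<le> y\<close> no_y in \<open>auto simp: N_def\<close>)
    qed
  qed
  then have N_meas: "N \<in> borel_measurable borel"
    by (rule borel_measurable_mono)
  define G where "G x = g (N x)" for x
  have G_int: "G integrable_on {s..t}" if "t \<in> T" for s t
  proof -
    have "compact (g ` {s..t})"
      using g(1) by (intro compact_continuous_image continuous_on_subset[OF g(1)]) auto
    then obtain B where B: "\<And>y. y \<in> {s..t} \<Longrightarrow> \<bar>g y\<bar> \<le> B"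
      unfolding bounded_iff[of "g ` {s..t}"] using compact_imp_bounded bounded_iff
      by (metis imageI real_norm_def)
    have "G \<in> borel_measurable borel"
      unfolding G_def using N_meas borel_measurable_continuous_onI[OF g(1)] by measurable
    then have "G \<in> borel_measurable (lebesgue_on {s..t})"
      by (intro measurable_restrict_space1 measurable_completion) auto
    \<comment> \<open>Since \<open>t\<close> belongs to \<open>T\<close>, the map \<open>N\<close>
      sends \<open>{s..t}\<close> into itself.\<close>
    moreover have "norm (G x) \<le> B" if "x \<in> {s..t}" for x
      unfolding G_def using B[of "N x"] N_ge[of x] N_le[OF \<open>t \<in> T\<close>, of x] that by auto
    ultimately show ?thesis
      by (intro measurable_bounded_by_integrable_imp_integrable[of G "{s..t}" "\<lambda>_. B"]) auto
  qed
  define F where "F t = (if c \<le> t then integral {c..t} G else - integral {t..c} G)" for t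
  have F_diff: "F t - F s = integral {s..t} G" if "s \<in> T" "t \<in> T" "s \<le> t" for s t
  proof -
    consider "c \<le> s" | "s < c" "c \<le> t" | "t < c"
      using that by linarith
    then show ?thesis
    proof cases
      case 1
      then show ?thesis
        using that Henstock_Kurzweil_Integration.integral_combine[OF 1 that(3) G_int[OF that(2)]]
        by (simp add: F_def)
    next
      case 2
      then show ?thesis
        using Henstock_Kurzweil_Integration.integral_combine[of s c t G] G_int[OF that(2)]
        by (simp add: F_def)
    next
      case 3
      then show ?thesis
        using that Henstock_Kurzweil_Integration.integral_combine[of s t c G] G_int[OF c]
        by (simp add: F_def)
    qed
  qed
  have est: "\<bar>F t - F s - L * (t - s)\<bar> \<le> e * (t - s)"
    if st: "s \<in> T" "t \<in> T" "s \<le> t" and e: "0 \<le> e" and "\<And>y. y \<in> {s..t} \<Longrightarrow> \<bar>g y - L\<bar> \<le> e" for s t L e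
  proof -
    have "((\<lambda>x. G x - L) has_integral (F t - F s - L * (t - s))) {s..t}"
      using has_integral_diff[OF integrable_integral[OF G_int[OF st(2), of s]] has_integral_const_real[of L s t]]
        F_diff[OF st] st by (simp add: mult.commute)
    moreover have "norm (G x - L) \<le> e" if "x \<in> {s..t}" for x
      unfolding G_def using that N_ge[of x] N_le[OF st(2), of x] \<open>\<And>y. y \<in> {s..t} \<Longrightarrow> \<bar>g y - L\<bar> \<le> e\<close>
      by auto
    ultimately show ?thesis
      using has_integral_bound_real[of e "{}" "\<lambda>x. G x - L" _ s t] e st by simp
  qed
  have est': "\<bar>F s - F t - g t * (s - t)\<bar> \<le> e * \<bar>s - t\<bar>"
    if st: "s \<in> T" "t \<in> T" "\<bar>s - t\<bar> < d" and e: "0 \<le> e"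
      and d: "\<And>y. \<bar>y - t\<bar> < d \<Longrightarrow> \<bar>g y - g t\<bar> \<le> e" for s t d e
  proof (cases "s \<le> t")
    case True
    then have "\<bar>F t - F s - g t * (t - s)\<bar> \<le> e * (t - s)"
      using st by (intro est e d) auto
    also have "F t - F s - g t * (t - s) = - (F s - F t - g t * (s - t))"
      by (simp add: algebra_simps)
    finally show ?thesis
      using True by (simp only: abs_minus_cancel) simp
  next
    case False
    then have "\<bar>F s - F t - g t * (s - t)\<bar> \<le> e * (s - t)"
      using st by (intro est e d) auto
    then show ?thesis
      using False by simp
  qed
  have der: "(F has_real_derivative g t) (at t within T)" if "t \<in> T" for t
    unfolding has_field_derivative_def has_derivative_within_alt
  proof (intro conjI allI impI)
    fix e :: real assume "e > 0"
    then obtain d where "d > 0" "\<And>y. \<bar>y - t\<bar> < d \<Longrightarrow> \<bar>g y - g t\<bar> < e"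
      using g(1) unfolding continuous_on_iff dist_real_def by (metis UNIV_I)
    then show "\<exists>d>0. \<forall>y\<in>T. norm (y - t) < d \<longrightarrow>
        norm (F y - F t - g t * (y - t)) \<le> e * norm (y - t)"
      using est'[OF _ that, of _ d e] \<open>e > 0\<close> by (intro exI[of _ d]) (force intro: less_imp_le)
  qed (rule bounded_linear_mult_right)
  have jump: "F u - F t = f u * (u - t)" if "t \<in> T" "u = fwd_jump T t" for t u
  proof -
    have u: "u \<in> T" "t \<le> u"
      using that fwd_jump_in[OF T] fwd_jump_ge by auto
    \<comment> \<open>No point of \<open>T\<close> lies strictly between \<open>t\<close> and its
      jump, so \<open>N\<close> is constant there except at \<open>t\<close>, a null set.\<close>
    have "N x = u" if "x \<in> {t..u} - {t}" for x
      using fwd_jump_le[of "N x" T t] N_in[OF u(1), of x] N_le[OF u(1), of x] N_ge[of x] that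
        \<open>u = fwd_jump T t\<close> by auto
    then have "integral {t..u} G = integral {t..u} (\<lambda>_. f u)"
      using g(2) u by (intro integral_spike[of "{t}"]) (auto simp: G_def)
    then show ?thesis
      using F_diff[OF that(1) u] u by (simp add: mult.commute)
  qed
  \<comment> \<open>Where the jump fixes \<open>t\<close>, the prescribed value is
    \<open>f t = g t\<close> and \<open>der\<close> applies; across a gap, continuity and
    \<open>jump\<close> are what is required.\<close>
  have "has_delta_deriv T F (f (fwd_jump T t)) t" if "t \<in> T" for t
    using that der[OF that] jump[OF that refl] g(2)[OF that] DERIV_continuous[OF der[OF that]]
    by (simp add: has_delta_deriv_iff)
  then show ?thesis
    by (auto simp: delta_antiderivative_def kappa_def)
qed

section \<open>The polynomial h_2 as an increment\<close>

text \<open>By the product rule \<open>(x - c) * x\<close> has derivative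
  \<open>\<sigma> t + (t - c)\<close>; subtracting an antiderivative of the jump leaves
  \<open>t - c\<close>.\<close>

lemma exists_delta_antiderivative_shift:
  assumes "closed T"
  shows "\<exists>A. delta_antiderivative T A (\<lambda>t. t - c)"
proof -
  obtain S where S: "delta_antiderivative T S (\<lambda>t. fwd_jump T t)"
    using exists_delta_antiderivative_fwd_jump[OF assms continuous_on_id] by auto
  have "has_delta_deriv T (\<lambda>x. (x - c) * x - S x) (t - c) t" if "t \<in> kappa T" for t
  proof -
    have "t \<in> T"
      using that by (simp add: kappa_def)
    then show ?thesis
      using has_delta_deriv_diff[OF _ has_delta_deriv_times_shift[OF _ has_delta_deriv_id], of t T S _ c]
        S that by (fastforce simp: delta_antiderivative_def)
  qed
  then show ?thesis
    by (auto simp: delta_antiderivative_def)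
qed

lemma h_poly_2_eq:
  assumes T: "closed T" "s \<in> T" "t \<in> T" and A: "delta_antiderivative T A (\<lambda>t. t - s)"
  shows "h_poly T 2 t s = A t - A s"
proof -
  have "delta_antiderivative T (\<lambda>x. x) (\<lambda>_. 1)"
    by (simp add: delta_antiderivative_def has_delta_deriv_id)
  then have "h_poly T (Suc 0) u s = u - s" if "u \<in> T" for u
    using delta_integral_eq[OF T(1,2) that] by simp
  then have "delta_antiderivative T A (\<lambda>u. h_poly T (Suc 0) u s)"
    using A by (auto simp: delta_antiderivative_def kappa_def)
  from delta_integral_eq[OF T this] show ?thesis
    by (simp add: numeral_2_eq_2)
qed

lemma delta_differentiable_imp_continuous_on:
  assumes "delta_differentiable T f"
  shows "continuous_on T f"
proof -
  have "delta_antiderivative T f (\<lambda>t. SOME D. has_delta_deriv T f D t)"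
    using assms unfolding delta_antiderivative_def delta_differentiable_def by (metis someI_ex)
  then show ?thesis
    by (rule continuous_on_delta_antiderivative)
qed

section \<open>The setting of the rectangle inequality\<close>

text \<open>\<open>A\<close> lives on all of \<open>T\<close>, so that its increments from
  \<open>\<alpha>\<close> are values of h_2 over \<open>T\<close>, while \<open>f\<close> is
  differentiated on \<open>J\<close>. The jumps in \<open>T\<close> and \<open>J\<close> agree
  before \<open>b\<close>.\<close>

locale rectangle =
  fixes T :: "real set" and a b \<alpha> :: real and A :: "real \<Rightarrow> real"
  assumes T: "closed T" and a: "a \<in> T" and b: "b \<in> T" and ab: "a < b"
    and \<alpha>: "\<alpha> \<in> T" "a \<le> \<alpha>" "\<alpha> \<le> b"
    and A: "delta_antiderivative T A (\<lambda>t. t - \<alpha>)"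
begin

abbreviation J :: "real set" where
  "J \<equiv> T \<inter> {a..b}"

text \<open>This is h_2(a, \<alpha>) + h_2(b, \<alpha>), see \<open>weight_eq\<close>.\<close>

definition weight :: real where
  "weight = A a - A \<alpha> + (A b - A \<alpha>)"

text \<open>The range of the supremum in \<open>deriv_bound\<close>.\<close>

definition index :: "real set" where
  "index = (if a < fwd_jump T a \<and> a < \<alpha> then T \<inter> {a..<b} else T \<inter> {a<..<b})"

lemma weight_eq: "h_poly T 2 a \<alpha> + h_poly T 2 b \<alpha> = weight"
  using h_poly_2_eq[OF T \<alpha>(1) _ A] a b by (simp add: weight_def)

lemma deriv_bound_eq: "deriv_bound T a b \<alpha> f = (SUP x\<in>index. ereal \<bar>delta_deriv J f x\<bar>)"
  by (simp add: deriv_bound_def index_def)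

lemma closed_J: "closed J"
  using T by (intro closed_Int) auto

lemma kappa_J: "t \<in> J \<Longrightarrow> t < b \<Longrightarrow> t \<in> kappa J"
  using b ab by (intro less_imp_kappa[of t J b]) auto

lemma fwd_jump_J: "t \<in> J \<Longrightarrow> t < b \<Longrightarrow> fwd_jump J t = fwd_jump T t"
  using T b by (intro fwd_jump_Int_atLeastAtMost) auto

lemma has_delta_deriv_A: "t \<in> T \<Longrightarrow> t < b \<Longrightarrow> has_delta_deriv T A (t - \<alpha>) t"
  using A less_imp_kappa[OF _ b] by (auto simp: delta_antiderivative_def)

lemma index_subset: "index \<subseteq> J \<inter> {..<b}"
  using ab by (auto simp: index_def)

text \<open>The only point that can be missing is \<open>a = \<alpha>\<close>, where a derivative of
  the form \<open>(t - \<alpha>) * D\<close> vanishes.\<close>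

lemma mem_index_or_eq_\<alpha>:
  assumes "t \<in> J" "t < b" "a < t \<or> a = t \<and> a < fwd_jump T a"
  shows "t \<in> index \<or> t = \<alpha>"
  using assms \<alpha> by (auto simp: index_def)

lemma delta_deriv_J:
  assumes "has_delta_deriv J f D t" "t \<in> J" "t < b"
  shows "delta_deriv J f t = D"
  using delta_deriv_eq[of t J b f D] assms ab b by auto

section \<open>The sign of the weight\<close>

text \<open>Mean value inequality for \<open>A\<close>; the choices 1 and -1 for \<open>p\<close>
  give upper and lower estimates of its increments.\<close>

lemma A_diff_le:
  assumes cd: "c \<in> T" "d \<in> T" "c \<le> d" "d \<le> b"
    and "\<And>t. t \<in> T \<Longrightarrow> c \<le> t \<Longrightarrow> t < d \<Longrightarrow> p * (t - \<alpha>) \<le> u"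
  shows "p * (A d - A c) \<le> u * (d - c)"
proof -
  let ?Q = "\<lambda>x. u * x + (- p) * A x"
  have "?Q c \<le> ?Q d"
  proof (rule delta_mono_left_closed[OF T cd(1-3)])
    have "continuous_on T A"
      using A by (rule continuous_on_delta_antiderivative)
    then show "continuous_on (T \<inter> {c..d}) ?Q"
      by (intro continuous_intros) (auto intro: continuous_on_subset)
    fix t assume t: "t \<in> T" "c \<le> t" "t < d"
    then have "has_delta_deriv T ?Q (u * 1 + (- p) * (t - \<alpha>)) t"
      using cd by (intro has_delta_deriv_linear_comb has_delta_deriv_id has_delta_deriv_A) auto
    then show "\<exists>D\<ge>0. has_delta_deriv T ?Q D t"
      using assms(5)[OF t] by (intro exI[of _ "u * 1 + (- p) * (t - \<alpha>)"]) auto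
  qed
  then show ?thesis
    by (simp add: algebra_simps)
qed

text \<open>\<open>A\<close> decreases up to \<open>\<alpha>\<close> and increases afterwards, so
  both summands are nonnegative. Strictness comes from the part after \<open>a\<close> if
  \<open>a < \<alpha>\<close>, and from the part after an intermediate point if
  \<open>\<alpha> = a\<close>.\<close>

lemma weight_pos:
  assumes "index \<noteq> {}"
  shows "0 < weight"
proof (cases "a < \<alpha>")
  case True
  have right: "A \<alpha> \<le> A b"
    using A_diff_le[of \<alpha> b "-1" 0] \<alpha> b by auto
  obtain x where x: "x \<in> T" "a < x" "x \<le> \<alpha>" "A x < A a"
  proof (cases "fwd_jump T a = a")
    case True
    then obtain x where x: "x \<in> T" "a < x" "x < \<alpha>"
      using fwd_jump_dense[OF _ \<alpha>(1) \<open>a < \<alpha>\<close>, of \<alpha>] \<open>a < \<alpha>\<close> by blast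
    then have "A x - A a \<le> (x - \<alpha>) * (x - a)"
      using A_diff_le[of a x 1 "x - \<alpha>"] a \<alpha> by auto
    also have "\<dots> < 0"
      using x by (intro mult_neg_pos) auto
    finally show ?thesis
      using that x by auto
  next
    case False
    define x where "x = fwd_jump T a"
    have x: "x \<in> T" "a < x" "x \<le> \<alpha>"
      using False fwd_jump_ge[of a T] fwd_jump_in[OF T a] fwd_jump_le[OF \<alpha>(1) True]
      by (auto simp: x_def)
    have "A x - A a = (a - \<alpha>) * (x - a)"
      using has_delta_deriv_A[OF a ab] a by (simp add: has_delta_deriv_iff x_def)
    also have "\<dots> < 0"
      using x True by (intro mult_neg_pos) auto
    finally show ?thesis
      using that x by auto
  qed
  moreover have "A \<alpha> \<le> A x"
    using A_diff_le[of x \<alpha> 1 0] x \<alpha> by auto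
  ultimately show ?thesis
    using right by (simp add: weight_def)
next
  case False
  then have \<alpha>_eq: "\<alpha> = a"
    using \<alpha> by simp
  obtain x where x: "x \<in> T" "a < x" "x < b"
    using assms \<alpha>_eq unfolding index_def by auto
  have "- (A x - A a) \<le> 0"
    using A_diff_le[of a x "-1" 0] a x \<alpha>_eq by auto
  \<comment> \<open>From \<open>x\<close> on, the derivative \<open>t - a\<close> of
    \<open>A\<close> is at least \<open>x - a\<close>.\<close>
  moreover have "- (A b - A x) \<le> (a - x) * (b - x)"
    using A_diff_le[of x b "-1" "a - x"] b x \<alpha>_eq by auto
  moreover have "(a - x) * (b - x) < 0"
    using x by (intro mult_neg_pos) auto
  ultimately show ?thesis
    unfolding weight_def by (simp add: \<alpha>_eq)
qed

text \<open>No point of \<open>T\<close> lies strictly between \<open>a\<close> and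
  \<open>b\<close>, so \<open>a\<close> jumps to \<open>b\<close>; being right-scattered,
  \<open>a\<close> would belong to \<open>index\<close> if \<open>a < \<alpha>\<close>.\<close>

lemma index_empty:
  assumes "index = {}"
  shows "\<alpha> = a" "fwd_jump T a = b"
proof -
  have no: "\<not> (a < x \<and> x < b)" if "x \<in> T" for x
    using assms that by (auto simp: index_def split: if_splits)
  show jump: "fwd_jump T a = b"
  proof (cases "fwd_jump T a = a")
    case True
    then show ?thesis
      using fwd_jump_dense[OF _ b ab ab] no by metis
  next
    case False
    then show ?thesis
      using no[OF fwd_jump_in[OF T a]] fwd_jump_ge[of a T] fwd_jump_le[OF b ab] by auto
  qed
  show "\<alpha> = a"
    using assms jump ab a \<alpha> by (auto simp: index_def split: if_splits)
qed

text \<open>Only the jump from \<open>a = \<alpha>\<close> to \<open>b\<close> remains, and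
  \<open>A\<close> does not change across it because its derivative at \<open>\<alpha>\<close> is
  0.\<close>

lemma weight_zero:
  assumes "index = {}"
  shows "weight = 0"
proof -
  have "A (fwd_jump T a) - A a = (a - \<alpha>) * (fwd_jump T a - a)"
    using has_delta_deriv_A[OF a ab] a by (simp add: has_delta_deriv_iff)
  then show ?thesis
    unfolding weight_def by (simp add: index_empty[OF assms])
qed

section \<open>The upper bound for the error\<close>

text \<open>Adding \<open>p * A x + e * x\<close> to \<open>G\<close>, with \<open>p = k\<close>
  left of \<open>\<alpha>\<close> and \<open>p = - k\<close> right of it, gives a nonnegative
  derivative on each side. The sign of \<open>k\<close> is free: \<open>- m\<close> serves the
  inequality, \<open>k \<ge> 0\<close> with slack \<open>e\<close> its sharpness.\<close>

lemma weight_comparison: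
  assumes contG: "continuous_on J G"
    and der: "\<And>t. t \<in> J \<Longrightarrow> t < b \<Longrightarrow> a < t \<or> a = t \<and> a < fwd_jump T a \<Longrightarrow>
      \<exists>D. has_delta_deriv J G D t \<and> k * \<bar>t - \<alpha>\<bar> - e \<le> D"
  shows "k * weight - e * (b - a) \<le> G b - G a"
proof -
  define Q where "Q p x = 1 * G x + 1 * (p * A x + e * x)" for p x
  have contA: "continuous_on J A"
    using continuous_on_delta_antiderivative[OF A] by (rule continuous_on_subset) simp
  have mono: "Q p c \<le> Q p d"
    if cd: "c \<in> J" "d \<in> J" "c \<le> d"
      and p: "\<And>t. c \<le> t \<Longrightarrow> t \<le> d \<Longrightarrow> p * (t - \<alpha>) = - k * \<bar>t - \<alpha>\<bar>" for p c d
  proof (rule delta_mono[OF closed_J cd])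
    show "continuous_on (J \<inter> {c..d}) (Q p)"
      unfolding Q_def by (intro continuous_intros continuous_on_subset[OF contG]
          continuous_on_subset[OF contA]) auto
    fix t assume t: "t \<in> J" "c < t \<or> c = t \<and> c < fwd_jump J c" "t < d"
    then have t': "t < b" "c \<le> t"
      using cd by auto
    obtain D where D: "has_delta_deriv J G D t" "k * \<bar>t - \<alpha>\<bar> - e \<le> D"
      using der[of t] t t' cd fwd_jump_J[of t] by (cases "a = t") auto
    have "has_delta_deriv J A (t - \<alpha>) t"
      using has_delta_deriv_subset[OF has_delta_deriv_A[of t], of J] fwd_jump_J[of t] t t' by auto
    with D(1) have "has_delta_deriv J (Q p) (1 * D + 1 * (p * (t - \<alpha>) + e * 1)) t"
      unfolding Q_def using t by (intro has_delta_deriv_linear_comb has_delta_deriv_id) auto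
    moreover have "p * (t - \<alpha>) = - k * \<bar>t - \<alpha>\<bar>"
      using p t t' by simp
    ultimately show "\<exists>D\<ge>0. has_delta_deriv J (Q p) D t"
      using D(2) by (intro exI[of _ "1 * D + 1 * (p * (t - \<alpha>) + e * 1)"]) auto
  qed
  have "Q k a \<le> Q k \<alpha>"
    using a ab \<alpha> by (intro mono) (auto simp: algebra_simps)
  moreover have "Q (- k) \<alpha> \<le> Q (- k) b"
    using b ab \<alpha> by (intro mono) auto
  ultimately show ?thesis
    by (simp add: Q_def weight_def algebra_simps)
qed

text \<open>In the derivative of \<open>G x = (x - \<alpha>) * f x - F x\<close> the values of
  \<open>f\<close> at the jump cancel, and the boundary terms of \<open>(x - \<alpha>) * f x\<close>
  form the rectangle sum.\<close>

lemma rectangle_error_eq: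
  assumes "delta_differentiable J f"
  obtains G where "continuous_on J G"
    and "\<And>t D. t \<in> J \<Longrightarrow> t < b \<Longrightarrow> has_delta_deriv J f D t \<Longrightarrow> has_delta_deriv J G ((t - \<alpha>) * D) t"
    and "rectangle_error T a b \<alpha> f = \<bar>G b - G a\<bar>"
proof -
  have f: "continuous_on J f"
    using assms by (rule delta_differentiable_imp_continuous_on)
  obtain F where F: "delta_antiderivative J F (\<lambda>t. f (fwd_jump J t))"
    using exists_delta_antiderivative_fwd_jump[OF closed_J f] by blast
  define G where "G x = (x - \<alpha>) * f x - F x" for x
  show ?thesis
  proof
    show "continuous_on J G"
      unfolding G_def using f continuous_on_delta_antiderivative[OF F] by (intro continuous_intros)
    show "has_delta_deriv J G ((t - \<alpha>) * D) t"
      if t: "t \<in> J" "t < b" "has_delta_deriv J f D t" for t D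
    proof -
      have "has_delta_deriv J F (f (fwd_jump J t)) t"
        using F kappa_J[OF t(1,2)] by (simp add: delta_antiderivative_def)
      from has_delta_deriv_diff[OF t(1) has_delta_deriv_times_shift[OF t(1,3), of \<alpha>] this]
      show ?thesis
        by (simp add: G_def[abs_def])
    qed
    have "delta_integral J a b (\<lambda>t. f (fwd_jump J t)) = F b - F a"
      using a b ab by (intro delta_integral_eq[OF closed_J _ _ F]) auto
    then have "rectangle_error T a b \<alpha> f = \<bar>- (G b - G a)\<bar>"
      by (simp add: rectangle_error_def G_def algebra_simps)
    then show "rectangle_error T a b \<alpha> f = \<bar>G b - G a\<bar>"
      by (simp only: abs_minus_cancel)
  qed
qed

lemma rectangle_inequality:
  assumes f: "delta_differentiable J f"
  shows "ereal (rectangle_error T a b \<alpha> f) \<le> deriv_bound T a b \<alpha> f * ereal weight"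
proof -
  obtain G where G: "continuous_on J G"
    and derG: "\<And>t D. t \<in> J \<Longrightarrow> t < b \<Longrightarrow> has_delta_deriv J f D t \<Longrightarrow> has_delta_deriv J G ((t - \<alpha>) * D) t"
    and err: "rectangle_error T a b \<alpha> f = \<bar>G b - G a\<bar>"
    using rectangle_error_eq[OF f] by blast
  have derf: "has_delta_deriv J f (delta_deriv J f t) t" if "t \<in> J" "t < b" for t
    using f kappa_J[OF that] delta_deriv_J[OF _ that] by (auto simp: delta_differentiable_def)
  show ?thesis
  proof (cases "index = {}")
    case True
    have "has_delta_deriv J G ((a - \<alpha>) * delta_deriv J f a) a"
      using a ab by (intro derG derf) auto
    then have "G b - G a = 0"
      using index_empty[OF True] a ab fwd_jump_J[of a] by (auto simp: has_delta_deriv_iff)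
    \<comment> \<open>Over the empty index the supremum is negative infinity, and its
      \<open>ereal\<close> product with 0 is 0.\<close>
    then show ?thesis
      using weight_zero[OF True] by (simp add: err flip: zero_ereal_def)
  next
    case False
    then have pos: "0 < weight"
      by (rule weight_pos)
    have le: "ereal \<bar>delta_deriv J f x\<bar> \<le> deriv_bound T a b \<alpha> f" if "x \<in> index" for x
      unfolding deriv_bound_eq using that by (rule SUP_upper)
    show ?thesis
    proof (cases "deriv_bound T a b \<alpha> f")
      case (real m)
      have bd: "\<bar>(t - \<alpha>) * delta_deriv J f t\<bar> \<le> m * \<bar>t - \<alpha>\<bar>"
        if "t \<in> J" "t < b" "a < t \<or> a = t \<and> a < fwd_jump T a" for t
        using mem_index_or_eq_\<alpha>[OF that] le[of t] real
        by (auto simp: abs_mult mult.commute[of m] intro: mult_left_mono)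
      have "(- m) * weight - 0 * (b - a) \<le> G b - G a"
      proof (rule weight_comparison[OF G])
        fix t assume t: "t \<in> J" "t < b" "a < t \<or> a = t \<and> a < fwd_jump T a"
        show "\<exists>D. has_delta_deriv J G D t \<and> - m * \<bar>t - \<alpha>\<bar> - 0 \<le> D"
          using bd[OF t] derG[OF t(1,2) derf[OF t(1,2)]]
          by (intro exI[of _ "(t - \<alpha>) * delta_deriv J f t"]) auto
      qed
      \<comment> \<open>The same comparison for the negative of \<open>G\<close>, written as a
        linear combination to fit \<open>has_delta_deriv_linear_comb\<close>.\<close>
      moreover have "(- m) * weight - 0 * (b - a) \<le> (0 * G b + (-1) * G b) - (0 * G a + (-1) * G a)"
      proof (rule weight_comparison)
        show "continuous_on J (\<lambda>x. 0 * G x + (-1) * G x)"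
          using G by (intro continuous_intros)
        fix t assume t: "t \<in> J" "t < b" "a < t \<or> a = t \<and> a < fwd_jump T a"
        show "\<exists>D. has_delta_deriv J (\<lambda>x. 0 * G x + (-1) * G x) D t \<and> - m * \<bar>t - \<alpha>\<bar> - 0 \<le> D"
          using bd[OF t] has_delta_deriv_linear_comb[OF t(1), where p = 0 and q = "-1",
              OF derG derG, OF t(1,2) derf[OF t(1,2)] t(1,2) derf[OF t(1,2)]]
          by (intro exI[of _ "- ((t - \<alpha>) * delta_deriv J f t)"]) auto
      qed
      ultimately show ?thesis
        by (simp add: err real)
    next
      \<comment> \<open>Positivity of the weight is essential here, as infinity times 0 is 0 in
        \<open>ereal\<close>.\<close>
      case PInf
      then show ?thesis
        using pos by simp
    next
      case MInf
      then show ?thesis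
        using le False by fastforce
    qed
  qed
qed

section \<open>Sharpness\<close>

text \<open>Reduces sharpness to a derivative \<open>D\<close> that is bounded by \<open>k\<close>,
  attains this bound in absolute value at one index point, and imitates
  \<open>k * sgn (t - \<alpha>)\<close> up to \<open>e\<close> after multiplication by
  \<open>t - \<alpha>\<close>.\<close>

lemma rectangle_error_ge:
  assumes der: "\<And>t. t \<in> kappa J \<Longrightarrow> has_delta_deriv J f (D t) t"
    and le: "\<And>t. t \<in> J \<Longrightarrow> t < b \<Longrightarrow> \<bar>D t\<bar> \<le> k"
    and x: "x \<in> index" "\<bar>D x\<bar> = k"
    and ge: "\<And>t. t \<in> J \<Longrightarrow> t < b \<Longrightarrow> k * \<bar>t - \<alpha>\<bar> - e \<le> (t - \<alpha>) * D t"
  shows "delta_differentiable J f" "deriv_bound T a b \<alpha> f = ereal k"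
    "k * weight - e * (b - a) \<le> rectangle_error T a b \<alpha> f"
proof -
  show f: "delta_differentiable J f"
    using der by (auto simp: delta_differentiable_def)
  have derJ: "has_delta_deriv J f (D t) t" if "t \<in> J" "t < b" for t
    using der kappa_J[OF that] by blast
  have eq: "delta_deriv J f t = D t" if "t \<in> index" for t
    using that index_subset derJ delta_deriv_J by blast
  show "deriv_bound T a b \<alpha> f = ereal k"
    unfolding deriv_bound_eq
  proof (rule antisym)
    show "(SUP x\<in>index. ereal \<bar>delta_deriv J f x\<bar>) \<le> ereal k"
    proof (rule SUP_least)
      fix t assume "t \<in> index"
      then show "ereal \<bar>delta_deriv J f t\<bar> \<le> ereal k"
        using eq[of t] le[of t] index_subset by (simp add: subset_iff)
    qed
    show "ereal k \<le> (SUP x\<in>index. ereal \<bar>delta_deriv J f x\<bar>)"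
      using x eq by (intro SUP_upper2[of x]) auto
  qed
  obtain G where G: "continuous_on J G"
    and derG: "\<And>t D. t \<in> J \<Longrightarrow> t < b \<Longrightarrow> has_delta_deriv J f D t \<Longrightarrow> has_delta_deriv J G ((t - \<alpha>) * D) t"
    and err: "rectangle_error T a b \<alpha> f = \<bar>G b - G a\<bar>"
    using rectangle_error_eq[OF f] by blast
  have "k * weight - e * (b - a) \<le> G b - G a"
    using derG derJ ge by (intro weight_comparison[OF G]) blast
  then show "k * weight - e * (b - a) \<le> rectangle_error T a b \<alpha> f"
    by (simp add: err)
qed

text \<open>The points of \<open>J\<close> avoid the interval between \<open>u\<close> and
  \<open>\<alpha>\<close>, so near each of its points, including \<open>\<alpha>\<close>, the time
  scale sees one linear branch of the absolute value.\<close>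

lemma sharp_left_scattered:
  assumes k: "0 \<le> k" and u: "u < \<alpha>" "\<And>s. s \<in> J \<Longrightarrow> s \<le> u \<or> \<alpha> \<le> s"
    and ne: "index \<noteq> {}"
  shows "\<exists>f. delta_differentiable J f \<and> deriv_bound T a b \<alpha> f = ereal k \<and>
    k * weight \<le> rectangle_error T a b \<alpha> f"
proof -
  define D where "D t = (if t < \<alpha> then - k else k)" for t
  define f where "f t = k * \<bar>t - \<alpha>\<bar>" for t
  have f_below: "f s = D t * (s - \<alpha>)" if "t < \<alpha>" "s \<le> \<alpha>" for s t
    using that by (simp add: f_def D_def abs_if algebra_simps)
  have f_above: "f s = D t * (s - \<alpha>)" if "\<alpha> \<le> t" "\<alpha> \<le> s" for s t
    using that by (simp add: f_def D_def)
  have "has_delta_deriv J f (D t) t" if t: "t \<in> J" for t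
  proof -
    have "\<exists>r>0. \<forall>s\<in>J. dist s t < r \<longrightarrow> D t * (s - \<alpha>) = f s"
    proof (cases "t < \<alpha>")
      case True
      then show ?thesis
        using f_below[OF True] by (intro exI[of _ "\<alpha> - t"]) (auto simp: dist_real_def)
    next
      case False
      have "\<alpha> \<le> s" if "s \<in> J" "dist s t < \<alpha> - u" for s
        using u(2)[OF that(1)] that(2) False by (auto simp: dist_real_def)
      then show ?thesis
        using f_above[of t] False u(1) by (intro exI[of _ "\<alpha> - u"]) auto
    qed
    then obtain r where "r > 0" "\<forall>s\<in>J. dist s t < r \<longrightarrow> D t * (s - \<alpha>) = f s"
      by blast
    moreover have "((\<lambda>s. D t * (s - \<alpha>)) has_real_derivative D t) (at t within J)"
      by (auto intro!: derivative_eq_intros)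
    ultimately have "(f has_real_derivative D t) (at t within J)"
      using t by (intro has_field_derivative_transform_within[of "\<lambda>s. D t * (s - \<alpha>)" "D t" t J r f]) auto
    moreover have "f (fwd_jump J t) - f t = D t * (fwd_jump J t - t)"
    proof (cases "t < \<alpha>")
      case True
      \<comment> \<open>As \<open>\<alpha>\<close> belongs to \<open>J\<close>, no jump crosses the
        kink.\<close>
      then have "fwd_jump J t \<le> \<alpha>"
        using \<alpha> by (intro fwd_jump_le) auto
      then show ?thesis
        using f_below[OF True, of t] f_below[OF True, of "fwd_jump J t"] True by (simp add: algebra_simps)
    next
      case False
      then show ?thesis
        using f_above[of t t] f_above[of t "fwd_jump J t"] fwd_jump_ge[of t J] by (simp add: algebra_simps)
    qed
    ultimately show ?thesis
      using t DERIV_continuous by (auto simp: has_delta_deriv_iff)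
  qed
  then have der: "has_delta_deriv J f (D t) t" if "t \<in> kappa J" for t
    using that by (auto simp: kappa_def)
  obtain x where x: "x \<in> index"
    using ne by blast
  have abs_D: "\<bar>D t\<bar> = k" for t
    using k by (simp add: D_def)
  have ge: "k * \<bar>t - \<alpha>\<bar> - 0 \<le> (t - \<alpha>) * D t" for t
    by (simp add: D_def abs_if algebra_simps)
  show ?thesis
    using rectangle_error_ge[where f = f and D = D and k = k and e = 0 and x = x, OF der _ x abs_D ge] abs_D
    by auto
qed

text \<open>The derivative is \<open>q \<circ> \<sigma>\<close>, where \<open>q\<close> rises from
  \<open>- k\<close> to \<open>k\<close> on a ramp of half-width \<open>\<delta> < e\<close> about
  \<open>\<alpha>\<close>. Off the ramp nothing is lost; on it the sign is right and
  \<open>k * \<bar>t - \<alpha>\<bar>\<close> is at most \<open>k * \<delta>\<close>.\<close>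

lemma sharp_left_dense:
  assumes k: "0 \<le> k" and dense: "\<And>u. u < \<alpha> \<Longrightarrow> \<exists>s\<in>T. a < s \<and> u < s \<and> s < \<alpha>"
    and e: "0 < e"
  shows "\<exists>f. delta_differentiable J f \<and> deriv_bound T a b \<alpha> f = ereal k \<and>
    k * weight - k * e * (b - a) \<le> rectangle_error T a b \<alpha> f"
proof -
  \<comment> \<open>\<open>x\<close> is the index point at which the derivative is
    \<open>- k\<close>; being left of \<open>p\<close>, it also forces
    \<open>\<delta> < e\<close>.\<close>
  obtain x where x: "x \<in> T" "a < x" "\<alpha> - e < x" "x < \<alpha>"
    using dense[of "\<alpha> - e"] e by auto
  obtain p where p: "p \<in> T" "x < p" "p < \<alpha>"
    using dense[OF x(4)] by auto
  define \<delta> where "\<delta> = \<alpha> - p"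
  have \<delta>: "0 < \<delta>" "\<delta> < e"
    using x p by (auto simp: \<delta>_def)
  \<comment> \<open>The kink sits at a point \<open>p\<close> of the time scale, so that no gap jumps over it.\<close>
  define q where "q t = k * max (- 1) (min 1 ((t - \<alpha>) / \<delta>))" for t
  have q_low: "q t = - k" if "t \<le> p" for t
  proof -
    have "(t - \<alpha>) / \<delta> \<le> - 1"
      using \<delta> that by (simp add: \<delta>_def field_simps)
    then show ?thesis
      by (simp add: q_def)
  qed
  have q_high: "q t = k" if "\<alpha> + \<delta> \<le> t" for t
  proof -
    have "1 \<le> (t - \<alpha>) / \<delta>"
      using \<delta> that by (simp add: field_simps)
    then show ?thesis
      by (simp add: q_def)
  qed
  have q_nonneg: "0 \<le> q t" if "\<alpha> \<le> t" for t
    using that k \<delta> by (simp add: q_def le_max_iff_disj)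
  have q_nonpos: "q t \<le> 0" if "t \<le> \<alpha>" for t
    using that k \<delta> by (auto simp: q_def mult_le_0_iff divide_le_0_iff min_le_iff_disj)
  have q_abs: "\<bar>q t\<bar> \<le> k" for t
  proof -
    have "\<bar>max (- 1) (min 1 ((t - \<alpha>) / \<delta>))\<bar> \<le> 1"
      by (auto simp: max_def min_def)
    then have "k * \<bar>max (- 1) (min 1 ((t - \<alpha>) / \<delta>))\<bar> \<le> k * 1"
      using k by (rule mult_left_mono)
    then show ?thesis
      using k by (simp add: q_def abs_mult)
  qed
  have "continuous_on J q"
    unfolding q_def using \<delta> by (intro continuous_intros) auto
  then obtain f where f: "delta_antiderivative J f (\<lambda>t. q (fwd_jump J t))"
    using exists_delta_antiderivative_fwd_jump[OF closed_J] by blast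
  have ge: "k * \<bar>t - \<alpha>\<bar> - k * e \<le> (t - \<alpha>) * q (fwd_jump J t)" for t
  proof -
    have \<delta>e: "k * \<delta> \<le> k * e"
      using k \<delta> by (intro mult_left_mono) auto
    consider "t < p" | "p \<le> t" "t < \<alpha>" | "\<alpha> \<le> t" "t < \<alpha> + \<delta>" | "\<alpha> + \<delta> \<le> t"
      by linarith
    then show ?thesis
    proof cases
      case 1
      then have "q (fwd_jump J t) = - k"
        using p x \<alpha> by (intro q_low fwd_jump_le) auto
      then show ?thesis
        using 1 p k e by (simp add: algebra_simps)
    next
      case 2
      then have "0 \<le> (t - \<alpha>) * q (fwd_jump J t)"
        using \<alpha> by (intro mult_nonpos_nonpos q_nonpos fwd_jump_le) auto
      moreover have "k * \<bar>t - \<alpha>\<bar> \<le> k * \<delta>"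
        using 2 k by (intro mult_left_mono) (auto simp: \<delta>_def)
      ultimately show ?thesis
        using \<delta>e by linarith
    next
      case 3
      then have "0 \<le> (t - \<alpha>) * q (fwd_jump J t)"
        using fwd_jump_ge[of t J] by (intro mult_nonneg_nonneg q_nonneg) auto
      moreover have "k * \<bar>t - \<alpha>\<bar> \<le> k * \<delta>"
        using 3 k by (intro mult_left_mono) auto
      ultimately show ?thesis
        using \<delta>e by linarith
    next
      case 4
      then have "q (fwd_jump J t) = k"
        using fwd_jump_ge[of t J] by (intro q_high) auto
      then show ?thesis
        using 4 \<delta> k e by (simp add: algebra_simps)
    qed
  qed
  have "x \<in> index"
    using x p \<alpha> by (auto simp: index_def)
  moreover have "\<bar>q (fwd_jump J x)\<bar> = k"
    using q_low[OF fwd_jump_le[of p J x]] p x \<alpha> k by auto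
  ultimately show ?thesis
    using rectangle_error_ge[where f = f and D = "\<lambda>t. q (fwd_jump J t)" and k = k and e = "k * e" and x = x]
      f q_abs ge unfolding delta_antiderivative_def by blast
qed

lemma sharp:
  assumes "0 \<le> r" "0 \<le> k" "r < k * weight"
  shows "\<exists>f. delta_differentiable J f \<and> deriv_bound T a b \<alpha> f = ereal k \<and> r < rectangle_error T a b \<alpha> f"
proof (cases "\<forall>u<\<alpha>. \<exists>s\<in>T. a < s \<and> u < s \<and> s < \<alpha>")
  case True
  \<comment> \<open>With this choice the loss \<open>k * e * (b - a)\<close> is at most half the
    margin; \<open>k + 1\<close> keeps the denominator positive.\<close>
  define e where "e = (k * weight - r) / (2 * (k + 1) * (b - a))"
  have "0 < e"
    using assms ab by (auto simp: e_def intro!: divide_pos_pos mult_pos_pos)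
  have "k * e * (b - a) \<le> (k + 1) * e * (b - a)"
    using \<open>0 < e\<close> ab by (intro mult_right_mono) auto
  also have "\<dots> = (k * weight - r) / 2"
    using assms ab by (simp add: e_def divide_simps)
  also have "\<dots> < k * weight - r"
    using assms by simp
  finally have "r < k * weight - k * e * (b - a)"
    by simp
  with sharp_left_dense[OF assms(2) _ \<open>0 < e\<close>] True show ?thesis
    by (meson less_le_trans)
next
  case False
  then obtain u where u: "u < \<alpha>" "\<And>s. s \<in> T \<Longrightarrow> a < s \<Longrightarrow> s \<le> u \<or> \<alpha> \<le> s"
    by force
  \<comment> \<open>The gap below \<open>\<alpha>\<close> was obtained for points after
    \<open>a\<close>; the maximum also covers \<open>a\<close> itself when
    \<open>a < \<alpha>\<close>.\<close>
  define v where "v = (if a < \<alpha> then max a u else u)"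
  have v: "v < \<alpha>" "\<And>s. s \<in> J \<Longrightarrow> s \<le> v \<or> \<alpha> \<le> s"
    using u \<alpha> by (auto simp: v_def) (metis le_max_iff_disj less_eq_real_def)+
  \<comment> \<open>A zero weight would contradict \<open>0 \<le> r < k * weight\<close>.\<close>
  have "index \<noteq> {}"
    using weight_zero assms by auto
  from sharp_left_scattered[OF assms(2) v this] assms(3) show ?thesis
    by (meson less_le_trans)
qed

end

text \<open>Sharpness is meant for each fixed \<open>T\<close>, \<open>a\<close>, \<open>b\<close>,
  \<open>\<alpha>\<close> and each prescribed value \<open>K\<close> of the supremum: no smaller
  nonnegative \<open>R\<close> bounds the error of all \<open>f\<close> with that supremum. The
  product in \<open>ereal\<close> admits unbounded derivatives.\<close>

theorem proposition2:
  fixes T :: "real set" and a b \<alpha> :: real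
  assumes "time_scale T" and "a \<in> T" and "b \<in> T" and "a < b"
    and "\<alpha> \<in> T \<inter> {a..b}"
  shows "(\<forall>f. delta_differentiable (T \<inter> {a..b}) f \<longrightarrow>
            ereal (rectangle_error T a b \<alpha> f)
              \<le> deriv_bound T a b \<alpha> f * ereal (h_poly T 2 a \<alpha> + h_poly T 2 b \<alpha>)) \<and>
         (\<forall>K R. 0 \<le> R \<and> 0 \<le> K \<and> R < K * (h_poly T 2 a \<alpha> + h_poly T 2 b \<alpha>) \<longrightarrow>
            (\<exists>f. delta_differentiable (T \<inter> {a..b}) f \<and> deriv_bound T a b \<alpha> f = ereal K \<and>
                 R < rectangle_error T a b \<alpha> f))"
proof -
  have T: "closed T"
    using assms(1) by (simp add: time_scale_def)
  obtain A where "delta_antiderivative T A (\<lambda>t. t - \<alpha>)"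
    using exists_delta_antiderivative_shift[OF T] by blast
  then interpret rectangle T a b \<alpha> A
    using assms T by unfold_locales auto
  show ?thesis
    unfolding weight_eq using rectangle_inequality sharp by blast
qed

end
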